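(* Let $\sigma\in\mathcal K$. Then for almost every $x\in\Omega$ the sequence $\{\nu^{(\sigma)}_{m+t}(x)\}_{t\in\mathbb N}$ is unbounded.
   Context: Here $\mathbb N=\{1,2,\dots\}$, $n\in\mathbb N$, $n\geqslant 2$, $\Omega$ is a bounded domain (nonempty open connected set) of $\mathbb R^n$, and $|\cdot|$ is the Euclidean norm. For $y\in\mathbb R^n$, $\rho>0$ let $B(y,\rho)=\{x\in\mathbb R^n:|x-y|<\rho\}$; for $y\in\mathbb R^n$, $t\in\mathbb N$ let $Q_t(y)=\{x\in\mathbb R^n:|x_i-y_i|<\frac1{2t},\ i=1,\dots,n\}$. Let $Y_t=\{y\in\mathbb R^n: t y_i\in\mathbb Z,\ i=1,\dots,n\}$ and $X_t=\{y\in Y_t: Q_t(y)\subset\Omega\}$. A number $m\in\mathbb N$ is fixed such that $X_t\neq\emptyset$ for every $t\in\mathbb N$, $t>m$ (such $m$ exists). For $t>m$ let $G_t=\bigcup_{y\in X_t}B(y,\frac1{2t})\subset\Omega$, let $\chi_t:\Omega\to\mathbb R$ be the characteristic function of $G_t$ and, for $y\in X_t$, let $\chi_{t,y}:\Omega\to\mathbb R$ be the characteristic function of $B(y,\frac1{2t})$. $\mathcal K$ is the set of all functions $\sigma:[0,+\infty)\to(0,+\infty)$ such that: (i) $\sigma$ is continuous in $(0,+\infty)$; (ii) $\sigma\geqslant1$ in $[0,1]$; (iii) $\sigma(\rho)\to+\infty$ as $\rho>0$, $\rho\to0$; (iv) $\int_0^1\sigma(\rho)\rho^{n-1}d\rho<+\infty$.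 For $\sigma\in\mathcal K$ and $t\in\mathbb N$, $t>m$, the function $\nu_t^{(\sigma)}:\Omega\to\mathbb R$ is defined by $\nu_t^{(\sigma)}(x)=\sigma(1)(1-\chi_t(x))+\sum_{y\in X_t}\sigma(2t|x-y|)\chi_{t,y}(x)$. *)

theory Defs
  imports "HOL-Analysis.Analysis"
begin

definition cube :: "nat \<Rightarrow> real ^ 'n \<Rightarrow> (real ^ 'n) set" where
  "cube t y = {x. \<forall>i. \<bar>x $ i - y $ i\<bar> < 1 / (2 * real t)}"

definition grid :: "nat \<Rightarrow> (real ^ 'n) set" where
  "grid t = {y. \<forall>i. real t * y $ i \<in> \<int>}"

definition inner_grid :: "(real ^ 'n) set \<Rightarrow> nat \<Rightarrow> (real ^ 'n) set" where
  "inner_grid \<Omega> t = {y \<in> grid t. cube t y \<subseteq> \<Omega>}"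

definition ball_union :: "(real ^ 'n) set \<Rightarrow> nat \<Rightarrow> (real ^ 'n) set" where
  "ball_union \<Omega> t = (\<Union>y \<in> inner_grid \<Omega> t. ball y (1 / (2 * real t)))"

(* The class K in dimension n. A function from [0,oo) to (0,oo) is represented by a total
   function on the reals of which only the restriction to [0,oo) is constrained. As the integrand
   in the last condition is nonnegative and continuous on (0,1], its integrability is the
   finiteness of its integral. *)
definition weight_class :: "nat \<Rightarrow> (real \<Rightarrow> real) set" where
  "weight_class n = {\<sigma>.
     (\<forall>\<rho>\<ge>0. \<sigma> \<rho> > 0) \<and>
     continuous_on {0<..} \<sigma> \<and>
     (\<forall>\<rho>\<in>{0..1}. \<sigma> \<rho> \<ge> 1) \<and>
     filterlim \<sigma> at_top (at_right 0) \<and>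
     set_integrable lborel {0..1} (\<lambda>\<rho>. \<sigma> \<rho> * \<rho> ^ (n - 1))}"

(* Only the values at points of \<Omega> matter. The sum is a genuine finite sum when \<Omega> is bounded
   and t > 0: see finite_inner_grid. *)
definition nu :: "(real ^ 'n) set \<Rightarrow> (real \<Rightarrow> real) \<Rightarrow> nat \<Rightarrow> real ^ 'n \<Rightarrow> real" where
  "nu \<Omega> \<sigma> t x =
     \<sigma> 1 * (1 - indicator (ball_union \<Omega> t) x) +
     (\<Sum>y \<in> inner_grid \<Omega> t.
        \<sigma> (2 * real t * norm (x - y)) * indicator (ball y (1 / (2 * real t))) x)"

lemma finite_inner_grid:
  fixes \<Omega> :: "(real ^ 'n) set"
  assumes "bounded \<Omega>" and "t > 0"
  shows "finite (inner_grid \<Omega> t)"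
proof -
  obtain B where B: "\<And>x. x \<in> \<Omega> \<Longrightarrow> norm x \<le> B"
    using assms(1) by (auto simp: bounded_iff)
  define N where "N = \<lceil>real t * B\<rceil>"
  define I where "I = (of_int :: int \<Rightarrow> real) ` {-N..N}"
  let ?f = "\<lambda>y::real ^ 'n. \<lambda>i. real t * y $ i"
  have "?f y \<in> Pi\<^sub>E UNIV (\<lambda>_. I)" if y: "y \<in> inner_grid \<Omega> t" for y
  proof -
    have "y \<in> cube t y" using \<open>t > 0\<close> by (simp add: cube_def)
    then have "norm y \<le> B" using y B by (auto simp: inner_grid_def)
    have "real t * y $ i \<in> I" for i
    proof -
      obtain k where k: "real t * y $ i = of_int k"
        using y by (auto simp: inner_grid_def grid_def Ints_def)
      have "\<bar>y $ i\<bar> \<le> B" using component_le_norm_cart[of y i] \<open>norm y \<le> B\<close> by linarith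
      then have "real t * \<bar>y $ i\<bar> \<le> real t * B" by (intro mult_left_mono) auto
      then have "\<bar>real_of_int k\<bar> \<le> of_int N"
        unfolding k[symmetric] N_def abs_mult by linarith
      then have "k \<in> {-N..N}" by simp linarith
      then show ?thesis unfolding k I_def by blast
    qed
    then show ?thesis by auto
  qed
  then have "?f ` inner_grid \<Omega> t \<subseteq> Pi\<^sub>E UNIV (\<lambda>_. I)" by blast
  moreover have "finite (Pi\<^sub>E (UNIV :: 'n set) (\<lambda>_. I))"
    by (intro finite_PiE) (auto simp: I_def)
  ultimately have "finite (?f ` inner_grid \<Omega> t)" by (rule finite_subset)
  moreover have "inj_on ?f (inner_grid \<Omega> t)"
    using \<open>t > 0\<close> by (auto intro!: inj_onI simp: fun_eq_iff vec_eq_iff)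
  ultimately show ?thesis by (rule finite_imageD)
qed

end

(* By Dirichlet's simultaneous approximation theorem every point x has, for arbitrarily large t,
   a grid point y of mesh 1/t with t|x - y| arbitrarily small; once t is large, the cube around y
   lies in the open set. If x is not a rational point then x and y differ, so the summand of y
   is a value of the weight at a small positive argument, which is arbitrarily large. The excluded
   rational points are countable. *)

theory Submission
  imports Defs
begin

lemma grid_imp_rational:
  assumes "x \<in> grid t" and "t > 0"
  shows "x $ i \<in> \<rat>"
proof -
  have "real t * x $ i \<in> \<rat>" using assms(1) Ints_subset_Rats by (auto simp: grid_def)
  then have "(real t * x $ i) / real t \<in> \<rat>" by (intro Rats_divide) auto
  then show ?thesis using assms(2) by simp
qed

text \<open>Dirichlet yields a common denominator \<open>q\<close> for all coordinates but no lower
  bound on it. Taking the multiple \<open>q * S\<close> as mesh parameter forces \<open>t\<close>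
  past \<open>T\<close>; the error grows by the factor \<open>S\<close>, which a finer Dirichlet
  bound absorbs.\<close>

lemma grid_approx:
  fixes x :: "real ^ 'n"
  assumes "\<epsilon> > 0"
  obtains t y where "t \<ge> T" "t > 0" "y \<in> grid t" "real t * norm (x - y) < \<epsilon>"
proof -
  define K where "K = real CARD('n)"
  have "K > 0" by (simp add: K_def)
  define S where "S = Suc T"
  \<comment> \<open>Each coordinate of \<open>t (x - y)\<close> will be at most \<open>S / N\<close>
    in absolute value, so its l1 norm is at most \<open>K * S / N\<close>; this \<open>N\<close>
    pushes that below \<epsilon>.\<close>
  obtain N :: nat where N: "K * real S / \<epsilon> < real N" using reals_Archimedean2 by blast
  have "K * real S / \<epsilon> > 0" using \<open>K > 0\<close> assms by (simp add: S_def)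
  then have "N > 0" using N by (cases N) auto
  \<comment> \<open>Dirichlet's theorem indexes its numbers by naturals, so the coordinates are
    enumerated; \<psi> below inverts the enumeration.\<close>
  obtain \<phi> :: "nat \<Rightarrow> 'n" where \<phi>: "bij_betw \<phi> {0..<CARD('n)} UNIV"
    using ex_bij_betw_nat_finite[of "UNIV :: 'n set"] by auto
  obtain q p where q: "q > 0"
    and p: "\<And>j. j < CARD('n) \<Longrightarrow> \<bar>of_int q * x $ \<phi> j - of_int (p j)\<bar> < 1 / real N"
    using Dirichlet_approx_simult[OF \<open>N > 0\<close>, of "CARD('n)" "\<lambda>j. x $ \<phi> j"] by blast
  have "\<exists>j<CARD('n). \<phi> j = i" for i
    using bij_betw_imp_surj_on[OF \<phi>] by (metis UNIV_I atLeastLessThan_iff imageE)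
  then obtain \<psi> where \<psi>: "\<And>i. \<psi> i < CARD('n)" "\<And>i. \<phi> (\<psi> i) = i"
    by metis
  define t where "t = nat q * S"
  \<comment> \<open>The denominator \<open>q\<close> divides \<open>t\<close>, which puts
    \<open>y\<close> on the grid of mesh \<open>1 / t\<close>.\<close>
  define y :: "real ^ 'n" where "y = (\<chi> i. of_int (p (\<psi> i)) / of_int q)"
  have rt: "real t = of_int q * real S" using q by (simp add: t_def)
  have "nat q \<ge> 1" using q by linarith
  then have "t \<ge> S" by (simp add: t_def)
  have ty: "real t * y $ i = of_int (int S * p (\<psi> i))" for i
    using q by (simp add: rt y_def)
  have "y \<in> grid t" unfolding grid_def mem_Collect_eq ty by (intro allI Ints_of_int)
  have "\<bar>(real t *\<^sub>R (x - y)) $ i\<bar> \<le> real S / real N" for i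
  proof -
    have "(real t *\<^sub>R (x - y)) $ i = real S * (of_int q * x $ i - of_int (p (\<psi> i)))"
      using ty[of i] by (auto simp: rt algebra_simps)
    also have "\<bar>\<dots>\<bar> = real S * \<bar>of_int q * x $ i - of_int (p (\<psi> i))\<bar>" by (simp add: abs_mult)
    also have "\<dots> \<le> real S * (1 / real N)"
      using p[OF \<psi>(1)[of i]] by (intro mult_left_mono) (auto simp: \<psi>(2))
    finally show ?thesis by simp
  qed
  then have "(\<Sum>i\<in>UNIV. \<bar>(real t *\<^sub>R (x - y)) $ i\<bar>) \<le> of_nat CARD('n) * (real S / real N)"
    by (intro sum_bounded_above)
  moreover have "real t * norm (x - y) \<le> (\<Sum>i\<in>UNIV. \<bar>(real t *\<^sub>R (x - y)) $ i\<bar>)"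
    using norm_le_l1_cart[of "real t *\<^sub>R (x - y)"] by simp
  moreover have "of_nat CARD('n) * (real S / real N) < \<epsilon>"
    using N \<open>N > 0\<close> assms by (simp add: K_def field_simps)
  ultimately have "real t * norm (x - y) < \<epsilon>" by linarith
  with \<open>t \<ge> S\<close> \<open>y \<in> grid t\<close> show ?thesis by (intro that) (auto simp: S_def)
qed

text \<open>The l1 norm dominates the Euclidean one, so no point of the cube is farther from
  \<open>y\<close> than \<open>CARD('n)\<close> half-edges.\<close>

lemma cube_subset_ball:
  fixes y :: "real ^ 'n"
  assumes "norm (x - y) + real CARD('n) / (2 * real t) < r"
  shows "cube t y \<subseteq> ball x r"
proof
  fix z assume "z \<in> cube t y"
  then have "\<bar>(z - y) $ i\<bar> \<le> 1 / (2 * real t)" for i by (simp add: cube_def less_imp_le)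
  then have "(\<Sum>i\<in>UNIV. \<bar>(z - y) $ i\<bar>) \<le> of_nat CARD('n) * (1 / (2 * real t))"
    by (intro sum_bounded_above)
  then have "norm (z - y) \<le> real CARD('n) / (2 * real t)"
    using norm_le_l1_cart[of "z - y"] by simp
  moreover have "norm (x - z) \<le> norm (x - y) + norm (z - y)"
    using norm_triangle_ineq4[of "x - y" "z - y"] by simp
  ultimately show "z \<in> ball x r" using assms by (simp add: dist_norm)
qed

text \<open>Positivity of \<sigma> makes all other terms of \<open>nu\<close> nonnegative, and the
  last assumption places \<open>x\<close> in the ball around \<open>y\<close>, where the indicator
  is 1.\<close>

lemma weight_le_nu:
  assumes "bounded \<Omega>" and "t > 0" and pos: "\<And>\<rho>. \<rho> \<ge> 0 \<Longrightarrow> \<sigma> \<rho> > 0"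
    and "y \<in> inner_grid \<Omega> t" and "2 * real t * norm (x - y) < 1"
  shows "\<sigma> (2 * real t * norm (x - y)) \<le> nu \<Omega> \<sigma> t x"
proof -
  let ?f = "\<lambda>y. \<sigma> (2 * real t * norm (x - y)) * indicator (ball y (1 / (2 * real t))) x :: real"
  have "x \<in> ball y (1 / (2 * real t))"
    using assms(2,5) by (simp add: dist_norm norm_minus_commute field_simps)
  then have "\<sigma> (2 * real t * norm (x - y)) = ?f y" by simp
  also have "?f y \<le> (\<Sum>y\<in>inner_grid \<Omega> t. ?f y)"
    using finite_inner_grid[OF assms(1,2)] assms(4) pos
    by (intro member_le_sum) (auto simp: indicator_def less_imp_le)
  also have "\<dots> \<le> nu \<Omega> \<sigma> t x"
    using pos[of 1] by (simp add: nu_def indicator_def)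
  finally show ?thesis .
qed

lemma nu_unbounded_above:
  fixes \<Omega> :: "(real ^ 'n) set"
  assumes "open \<Omega>" and "bounded \<Omega>" and \<sigma>: "\<And>\<rho>. \<rho> \<ge> 0 \<Longrightarrow> \<sigma> \<rho> > 0"
    and lim: "filterlim \<sigma> at_top (at_right 0)"
    and "x \<in> \<Omega>" and irrational: "\<not> (\<forall>i. x $ i \<in> \<rat>)"
  obtains t where "t \<ge> T" "nu \<Omega> \<sigma> t x > M"
proof -
  obtain \<delta> where "\<delta> > 0" and \<delta>: "\<And>\<rho>. 0 < \<rho> \<Longrightarrow> \<rho> < \<delta> \<Longrightarrow> \<sigma> \<rho> > M"
    using lim unfolding filterlim_at_top_dense eventually_at_right_field by blast
  obtain r where "r > 0" and r: "ball x r \<subseteq> \<Omega>"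
    using assms(1,5) open_contains_ball by blast
  define K where "K = real CARD('n)"
  \<comment> \<open>Multiplied by \<open>t\<close>, the condition of \<open>cube_subset_ball\<close>
    reads \<open>t * norm (x - y) + K / 2 < r * t\<close>. The left side will stay below
    \<open>1 + K\<close>, so \<open>t > (1 + K) / r\<close> suffices.\<close>
  obtain R :: nat where R: "(1 + K) / r < real R" using reals_Archimedean2 by blast
  \<comment> \<open>The bound \<open>1 / 2\<close> puts \<open>x\<close> in the ball around
    \<open>y\<close>; the bound \<open>\<delta> / 2\<close> makes the argument of \<sigma> smaller
    than \<delta>.\<close>
  obtain t y where t: "t \<ge> max T R" "t > 0" and y: "y \<in> grid t"
    and le: "real t * norm (x - y) < min (1 / 2) (\<delta> / 2)"
    using grid_approx[of "min (1 / 2) (\<delta> / 2)" "max T R" x] \<open>\<delta> > 0\<close> by auto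
  have "(1 + K) / r < real t" using R t by linarith
  then have "1 + K < r * real t" using \<open>r > 0\<close> by (simp add: field_simps)
  moreover have "real t * norm (x - y) + K / 2 < 1 + K" using le by (simp add: K_def)
  ultimately have "real t * norm (x - y) + K / 2 < r * real t" by linarith
  then have "norm (x - y) + K / (2 * real t) < r" using t by (simp add: field_simps)
  then have "y \<in> inner_grid \<Omega> t"
    using cube_subset_ball[of x y t r] y r by (auto simp: inner_grid_def K_def)
  moreover have "2 * real t * norm (x - y) < 1" using le by simp
  ultimately have "\<sigma> (2 * real t * norm (x - y)) \<le> nu \<Omega> \<sigma> t x"
    using assms(2) t(2) \<sigma> by (intro weight_le_nu) auto
  \<comment> \<open>The argument must be strictly positive: the limit at 0 from the right says
    nothing about \<open>\<sigma> 0\<close>.\<close>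
  moreover have "x \<noteq> y" using grid_imp_rational[OF y t(2)] irrational by auto
  then have "\<sigma> (2 * real t * norm (x - y)) > M" using le t(2) by (intro \<delta>) auto
  ultimately show ?thesis using t by (intro that[of t]) auto
qed

theorem theorem5p1:
  fixes \<Omega> :: "(real ^ 'n) set" and m :: nat and \<sigma> :: "real \<Rightarrow> real"
  assumes "CARD('n) \<ge> 2"
    and "\<Omega> \<noteq> {}" and "open \<Omega>" and "connected \<Omega>" and "bounded \<Omega>"
    and "m \<ge> 1" and "\<And>t. t > m \<Longrightarrow> inner_grid \<Omega> t \<noteq> {}"
    and "\<sigma> \<in> weight_class (CARD('n))"
  shows "AE x\<in>\<Omega> in lebesgue. \<not> bounded ((\<lambda>t. nu \<Omega> \<sigma> (m + t) x) ` {1..})"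
proof -
  have \<sigma>: "\<And>\<rho>. \<rho> \<ge> 0 \<Longrightarrow> \<sigma> \<rho> > 0" "filterlim \<sigma> at_top (at_right 0)"
    using assms(8) by (auto simp: weight_class_def)
  have "\<not> bounded ((\<lambda>t. nu \<Omega> \<sigma> (m + t) x) ` {1..})"
    if x: "x \<in> \<Omega>" "\<not> (\<forall>i. x $ i \<in> \<rat>)" for x
  proof
    assume "bounded ((\<lambda>t. nu \<Omega> \<sigma> (m + t) x) ` {1..})"
    then obtain B where B: "\<And>t. t \<ge> 1 \<Longrightarrow> \<bar>nu \<Omega> \<sigma> (m + t) x\<bar> \<le> B"
      by (auto simp: bounded_iff)
    \<comment> \<open>The threshold \<open>Suc m\<close> lets \<open>t\<close> be written as
      \<open>m + (t - m)\<close> with an index \<open>t - m\<close> of at least 1.\<close>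
    obtain t where t: "t \<ge> Suc m" "nu \<Omega> \<sigma> t x > B"
      using nu_unbounded_above[OF assms(3,5) \<sigma> x] by blast
    moreover have "t - m \<ge> 1" using t(1) by linarith
    ultimately show False using B[of "t - m"] by simp
  qed
  moreover have "{x :: real ^ 'n. \<forall>i. x $ i \<in> \<rat>} \<in> null_sets lebesgue"
    using countable_vector[of "\<lambda>_. \<rat>"] countable_rat
    by (intro null_sets_completionI countable_imp_null_set_lborel) auto
  ultimately show ?thesis by (intro AE_I') auto
qed

end
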